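(* Let $\mathcal C$ be an extensive category. Suppose given a commutative square in $\mathsf{Fam}(\mathcal C)$ consisting of morphisms $(f,\hat f)\colon(a_w)_{w\in W}\to(b_x)_{x\in X}$, $(g,\hat g)\colon(a_w)_{w\in W}\to(c_y)_{y\in Y}$, $(h,\hat h)\colon(b_x)_{x\in X}\to(d_z)_{z\in Z}$, $(k,\hat k)\colon(c_y)_{y\in Y}\to(d_z)_{z\in Z}$ with $(h,\hat h)\circ(f,\hat f)=(k,\hat k)\circ(g,\hat g)$, such that the square of sets $$W\xrightarrow{f}X\xrightarrow{h}Z,\qquad W\xrightarrow{g}Y\xrightarrow{k}Z$$ is a pullback and, for each $w\in W$, with $z=kgw=hfw$, the square in $\mathcal C$ $$a_w\xrightarrow{\hat f_w}b_{fw}\xrightarrow{\hat h_{fw}}d_z,\qquad a_w\xrightarrow{\hat g_w}c_{gw}\xrightarrow{\hat k_{gw}}d_z$$ is a pullback. Then the square in $\mathcal C$ $$\sum_{w\in W}a_w\xrightarrow{\sum_f\hat f}\sum_{x\in X}b_x\xrightarrow{\sum_h\hat h}\sum_{z\in Z}d_z,\qquad\sum_{w\in W}a_w\xrightarrow{\sum_g\hat g}\sum_{y\in Y}c_y\xrightarrow{\sum_k\hat k}\sum_{z\in Z}d_z$$ is a pullback.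
   Context: A category $\mathcal C$ with small coproducts is extensive if the functor $\sum\colon\prod_{i\in I}\mathcal C\downarrow X_i\to\mathcal C\downarrow\sum_{i\in I}X_i$ is an equivalence for every small family $(X_i)_{i\in I}$ of objects. $\mathsf{Fam}(\mathcal C)$ is the free coproduct completion: objects are set-indexed families $(c_x)_{x\in X}$ of objects of $\mathcal C$; a morphism $(f,\hat f)\colon(c_x)_{x\in X}\to(d_y)_{y\in Y}$ is a function $f\colon X\to Y$ with morphisms $\hat f_x\colon c_x\to d_{fx}$ for $x\in X$. $\sum_f\hat f\colon\sum_xc_x\to\sum_yd_y$ is the induced morphism between coproducts. *)

theory Defs
  imports Main "HOL-Library.FuncSet"
begin

section \<open>Categories\<close>

record ('o, 'm) cat =
  Obj :: "'o set"
  Arr :: "'m set"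
  Dom :: "'m \<Rightarrow> 'o"
  Cod :: "'m \<Rightarrow> 'o"
  Ident :: "'o \<Rightarrow> 'm"
  Comp :: "'m \<Rightarrow> 'm \<Rightarrow> 'm"  (infixl \<open>\<cdot>\<index>\<close> 70)

definition Hom :: "('o, 'm, 'r) cat_scheme \<Rightarrow> 'o \<Rightarrow> 'o \<Rightarrow> 'm set"
  where "Hom C x y = {f \<in> Arr C. Dom C f = x \<and> Cod C f = y}"

locale category =
  fixes C :: "('o, 'm, 'r) cat_scheme" (structure)
  assumes dom_obj: "f \<in> Arr C \<Longrightarrow> Dom C f \<in> Obj C"
    and cod_obj: "f \<in> Arr C \<Longrightarrow> Cod C f \<in> Obj C"
    and ident_hom: "x \<in> Obj C \<Longrightarrow> Ident C x \<in> Hom C x x"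
    and comp_hom: "g \<in> Hom C y z \<Longrightarrow> f \<in> Hom C x y \<Longrightarrow> g \<cdot> f \<in> Hom C x z"
    and comp_ident: "f \<in> Hom C x y \<Longrightarrow> f \<cdot> Ident C x = f"
    and ident_comp: "f \<in> Hom C x y \<Longrightarrow> Ident C y \<cdot> f = f"
    and comp_assoc: "h \<in> Hom C z t \<Longrightarrow> g \<in> Hom C y z \<Longrightarrow> f \<in> Hom C x y \<Longrightarrow>
      h \<cdot> g \<cdot> f = h \<cdot> (g \<cdot> f)"

definition is_iso :: "('o, 'm, 'r) cat_scheme \<Rightarrow> 'm \<Rightarrow> bool"
  where "is_iso C f \<longleftrightarrow> f \<in> Arr C \<and>
    (\<exists>g \<in> Hom C (Cod C f) (Dom C f).
       g \<cdot>\<^bsub>C\<^esub> f = Ident C (Dom C f) \<and> f \<cdot>\<^bsub>C\<^esub> g = Ident C (Cod C f))"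

text \<open>The square with sides \<open>p : P \<rightarrow> A\<close>, \<open>q : P \<rightarrow> B\<close>, \<open>u : A \<rightarrow> S\<close>, \<open>v : B \<rightarrow> S\<close> commutes and
  is a pullback.\<close>

definition is_pullback :: "('o, 'm, 'r) cat_scheme \<Rightarrow> 'm \<Rightarrow> 'm \<Rightarrow> 'm \<Rightarrow> 'm \<Rightarrow> bool"
  where "is_pullback C p q u v \<longleftrightarrow>
    p \<in> Arr C \<and> q \<in> Arr C \<and> u \<in> Arr C \<and> v \<in> Arr C \<and>
    Dom C p = Dom C q \<and> Cod C p = Dom C u \<and> Cod C q = Dom C v \<and> Cod C u = Cod C v \<and>
    u \<cdot>\<^bsub>C\<^esub> p = v \<cdot>\<^bsub>C\<^esub> q \<and>
    (\<forall>t \<in> Obj C. \<forall>r \<in> Hom C t (Dom C u). \<forall>s \<in> Hom C t (Dom C v).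
       u \<cdot>\<^bsub>C\<^esub> r = v \<cdot>\<^bsub>C\<^esub> s \<longrightarrow>
       (\<exists>!m. m \<in> Hom C t (Dom C p) \<and> p \<cdot>\<^bsub>C\<^esub> m = r \<and> q \<cdot>\<^bsub>C\<^esub> m = s))"

definition is_coproduct ::
    "('o, 'm, 'r) cat_scheme \<Rightarrow> 'i set \<Rightarrow> ('i \<Rightarrow> 'o) \<Rightarrow> 'o \<Rightarrow> ('i \<Rightarrow> 'm) \<Rightarrow> bool"
  where "is_coproduct C I X s \<iota> \<longleftrightarrow>
    s \<in> Obj C \<and> (\<forall>i \<in> I. \<iota> i \<in> Hom C (X i) s) \<and>
    (\<forall>t \<in> Obj C. \<forall>g. (\<forall>i \<in> I. g i \<in> Hom C (X i) t) \<longrightarrow>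
       (\<exists>!u. u \<in> Hom C s t \<and> (\<forall>i \<in> I. u \<cdot>\<^bsub>C\<^esub> \<iota> i = g i)))"


section \<open>Functors and equivalences\<close>

definition is_functor :: "('o1, 'm1, 'r1) cat_scheme \<Rightarrow> ('o2, 'm2, 'r2) cat_scheme \<Rightarrow>
    ('o1 \<Rightarrow> 'o2) \<Rightarrow> ('m1 \<Rightarrow> 'm2) \<Rightarrow> bool"
  where "is_functor C D Fo Fa \<longleftrightarrow>
    (\<forall>x \<in> Obj C. Fo x \<in> Obj D) \<and>
    (\<forall>f \<in> Arr C. Fa f \<in> Hom D (Fo (Dom C f)) (Fo (Cod C f))) \<and>
    (\<forall>x \<in> Obj C. Fa (Ident C x) = Ident D (Fo x)) \<and>
    (\<forall>f \<in> Arr C. \<forall>g \<in> Arr C. Dom C g = Cod C f \<longrightarrow> Fa (g \<cdot>\<^bsub>C\<^esub> f) = Fa g \<cdot>\<^bsub>D\<^esub> Fa f)"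

definition is_natural_iso :: "('o1, 'm1, 'r1) cat_scheme \<Rightarrow> ('o2, 'm2, 'r2) cat_scheme \<Rightarrow>
    ('o1 \<Rightarrow> 'o2) \<Rightarrow> ('m1 \<Rightarrow> 'm2) \<Rightarrow> ('o1 \<Rightarrow> 'o2) \<Rightarrow> ('m1 \<Rightarrow> 'm2) \<Rightarrow> ('o1 \<Rightarrow> 'm2) \<Rightarrow> bool"
  where "is_natural_iso C D Fo Fa Go Ga \<tau> \<longleftrightarrow>
    (\<forall>x \<in> Obj C. \<tau> x \<in> Hom D (Fo x) (Go x) \<and> is_iso D (\<tau> x)) \<and>
    (\<forall>f \<in> Arr C. Ga f \<cdot>\<^bsub>D\<^esub> \<tau> (Dom C f) = \<tau> (Cod C f) \<cdot>\<^bsub>D\<^esub> Fa f)"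

definition is_equivalence :: "('o1, 'm1, 'r1) cat_scheme \<Rightarrow> ('o2, 'm2, 'r2) cat_scheme \<Rightarrow>
    ('o1 \<Rightarrow> 'o2) \<Rightarrow> ('m1 \<Rightarrow> 'm2) \<Rightarrow> bool"
  where "is_equivalence C D Fo Fa \<longleftrightarrow>
    is_functor C D Fo Fa \<and>
    (\<exists>Go Ga \<eta> \<epsilon>. is_functor D C Go Ga \<and>
       is_natural_iso C C (\<lambda>x. x) (\<lambda>f. f) (\<lambda>x. Go (Fo x)) (\<lambda>f. Ga (Fa f)) \<eta> \<and>
       is_natural_iso D D (\<lambda>y. Fo (Go y)) (\<lambda>g. Fa (Ga g)) (\<lambda>y. y) (\<lambda>g. g) \<epsilon>)"


section \<open>Sets, slices, products and families\<close>

text \<open>Smallness is relative to a type \<open>'i\<close>: the small sets are the subsets of \<open>'i\<close>. Functions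
  on a set are taken extensional (value \<open>undefined\<close> outside the set), so that equality of
  arrows is equality of functions. An arrow carries its domain and codomain.\<close>

definition Set_cat :: "('i set, 'i set \<times> 'i set \<times> ('i \<Rightarrow> 'i)) cat"
  where "Set_cat = \<lparr>
    Obj = UNIV,
    Arr = {(A, B, f). f \<in> A \<rightarrow>\<^sub>E B},
    Dom = (\<lambda>(A, B, f). A),
    Cod = (\<lambda>(A, B, f). B),
    Ident = (\<lambda>A. (A, A, \<lambda>x \<in> A. x)),
    Comp = (\<lambda>(B', C, g) (A, B, f). (A, C, compose A g f))\<rparr>"

definition Slice :: "('o, 'm, 'r) cat_scheme \<Rightarrow> 'o \<Rightarrow> ('m, 'm \<times> 'm \<times> 'm) cat"
  where "Slice C x = \<lparr>
    Obj = {p \<in> Arr C. Cod C p = x},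
    Arr = {(p, q, h). p \<in> Arr C \<and> Cod C p = x \<and> q \<in> Arr C \<and> Cod C q = x \<and>
             h \<in> Hom C (Dom C p) (Dom C q) \<and> q \<cdot>\<^bsub>C\<^esub> h = p},
    Dom = (\<lambda>(p, q, h). p),
    Cod = (\<lambda>(p, q, h). q),
    Ident = (\<lambda>p. (p, p, Ident C (Dom C p))),
    Comp = (\<lambda>(q', r, k) (p, q, h). (p, r, k \<cdot>\<^bsub>C\<^esub> h))\<rparr>"

definition Prod_cat :: "'i set \<Rightarrow> ('i \<Rightarrow> ('o, 'm) cat) \<Rightarrow> ('i \<Rightarrow> 'o, 'i \<Rightarrow> 'm) cat"
  where "Prod_cat I D = \<lparr>
    Obj = (\<Pi>\<^sub>E i \<in> I. Obj (D i)),
    Arr = (\<Pi>\<^sub>E i \<in> I. Arr (D i)),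
    Dom = (\<lambda>\<phi>. \<lambda>i \<in> I. Dom (D i) (\<phi> i)),
    Cod = (\<lambda>\<phi>. \<lambda>i \<in> I. Cod (D i) (\<phi> i)),
    Ident = (\<lambda>x. \<lambda>i \<in> I. Ident (D i) (x i)),
    Comp = (\<lambda>\<psi> \<phi>. \<lambda>i \<in> I. \<psi> i \<cdot>\<^bsub>D i\<^esub> \<phi> i)\<rparr>"

type_synonym ('o, 'i) fam = "'i set \<times> ('i \<Rightarrow> 'o)"

type_synonym ('o, 'm, 'i) fam_arr =
  "('o, 'i) fam \<times> ('o, 'i) fam \<times> ('i \<Rightarrow> 'i) \<times> ('i \<Rightarrow> 'm)"

definition Fam :: "('o, 'm, 'r) cat_scheme \<Rightarrow> (('o, 'i) fam, ('o, 'm, 'i) fam_arr) cat"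
  where "Fam C = \<lparr>
    Obj = {(I, c). c \<in> I \<rightarrow>\<^sub>E Obj C},
    Arr = {((I, c), (J, d), f, fh). c \<in> I \<rightarrow>\<^sub>E Obj C \<and> d \<in> J \<rightarrow>\<^sub>E Obj C \<and>
             f \<in> I \<rightarrow>\<^sub>E J \<and> fh \<in> (\<Pi>\<^sub>E i \<in> I. Hom C (c i) (d (f i)))},
    Dom = (\<lambda>(c, d, f, fh). c),
    Cod = (\<lambda>(c, d, f, fh). d),
    Ident = (\<lambda>(I, c). ((I, c), (I, c), \<lambda>i \<in> I. i, \<lambda>i \<in> I. Ident C (c i))),
    Comp = (\<lambda>(d', e, g, gh) ((I, c), d, f, fh).
              ((I, c), e, compose I g f, \<lambda>i \<in> I. gh (f i) \<cdot>\<^bsub>C\<^esub> fh i))\<rparr>"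


section \<open>Small coproducts and extensivity\<close>

text \<open>The coproducts are a chosen structure, needed for \<open>\<Sum>\<close> to be a functor; this choice is
  an arbitrary one.\<close>

record ('o, 'm, 'i) coprod_cat = "('o, 'm) cat" +
  Coprod :: "'i set \<Rightarrow> ('i \<Rightarrow> 'o) \<Rightarrow> 'o"
  Inj :: "'i set \<Rightarrow> ('i \<Rightarrow> 'o) \<Rightarrow> 'i \<Rightarrow> 'm"

locale category_with_small_coproducts = category C
  for C :: "('o, 'm, 'i, 'r) coprod_cat_scheme" (structure) +
  assumes coproduct: "X \<in> I \<rightarrow>\<^sub>E Obj C \<Longrightarrow> is_coproduct C I X (Coprod C I X) (Inj C I X)"

text \<open>The morphism \<open>\<Sum>\<^sub>f fh\<close> induced by a morphism of families.\<close>

definition fam_sum :: "('o, 'm, 'i, 'r) coprod_cat_scheme \<Rightarrow> ('o, 'm, 'i) fam_arr \<Rightarrow> 'm"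
  where "fam_sum C = (\<lambda>((I, c), (J, d), f, fh).
    THE u. u \<in> Hom C (Coprod C I c) (Coprod C J d) \<and>
      (\<forall>i \<in> I. u \<cdot>\<^bsub>C\<^esub> Inj C I c i = Inj C J d (f i) \<cdot>\<^bsub>C\<^esub> fh i))"

text \<open>The functor \<open>\<Sum>\<close> from the product of the slices over the \<open>X i\<close> to the slice over their
  coproduct.\<close>

definition slice_sum_obj ::
    "('o, 'm, 'i, 'r) coprod_cat_scheme \<Rightarrow> 'i set \<Rightarrow> ('i \<Rightarrow> 'o) \<Rightarrow> ('i \<Rightarrow> 'm) \<Rightarrow> 'm"
  where "slice_sum_obj C I X p =
    fam_sum C ((I, \<lambda>i \<in> I. Dom C (p i)), (I, X), \<lambda>i \<in> I. i, p)"

definition slice_sum_arr ::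
    "('o, 'm, 'i, 'r) coprod_cat_scheme \<Rightarrow> 'i set \<Rightarrow> ('i \<Rightarrow> 'o) \<Rightarrow> ('i \<Rightarrow> 'm \<times> 'm \<times> 'm) \<Rightarrow>
      'm \<times> 'm \<times> 'm"
  where "slice_sum_arr C I X \<phi> =
    (let p = (\<lambda>i \<in> I. fst (\<phi> i)); q = (\<lambda>i \<in> I. fst (snd (\<phi> i))); h = (\<lambda>i \<in> I. snd (snd (\<phi> i)))
     in (slice_sum_obj C I X p, slice_sum_obj C I X q,
         fam_sum C ((I, \<lambda>i \<in> I. Dom C (p i)), (I, \<lambda>i \<in> I. Dom C (q i)), \<lambda>i \<in> I. i, h)))"

locale extensive_category = category_with_small_coproducts C
  for C :: "('o, 'm, 'i, 'r) coprod_cat_scheme" (structure) +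
  assumes extensive: "X \<in> I \<rightarrow>\<^sub>E Obj C \<Longrightarrow>
    is_equivalence (Prod_cat I (\<lambda>i. Slice C (X i))) (Slice C (Coprod C I X))
      (slice_sum_obj C I X) (slice_sum_arr C I X)"

end

theory Submission
  imports Defs
begin

text \<open>
  Essential surjectivity of \<open>\<Sum>\<close> splits every object over a coproduct into a coproduct of objects
  over the summands; for the empty family this says that the initial object is strict. Fullness,
  applied to families concentrated in one index, gives that coproduct injections are monic and
  disjoint. Given \<open>r : t \<rightarrow> \<Sum> b\<close> and \<open>s : t \<rightarrow> \<Sum> c\<close> that agree over \<open>\<Sum> d\<close>, split \<open>t\<close> along \<open>r\<close> and
  each piece along \<open>s\<close>. A piece over \<open>b x\<close> and \<open>c y\<close> is initial unless \<open>h x = k y\<close>, and then it lifts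
  uniquely to \<open>a w\<close> for the unique \<open>w\<close> over \<open>(x, y)\<close>. Two maps \<open>t \<rightarrow> \<Sum> a\<close> with the same composites
  are compared in the same way, after splitting \<open>t\<close> along both of them.
\<close>

section \<open>Isomorphisms and slice categories\<close>

context category
begin

lemma homD: "f \<in> Hom C x y \<Longrightarrow> f \<in> Arr C \<and> Dom C f = x \<and> Cod C f = y \<and> x \<in> Obj C \<and> y \<in> Obj C"
  using dom_obj cod_obj by (auto simp: Hom_def)

lemma isoE:
  assumes "is_iso C f" "f \<in> Hom C x y"
  obtains g where "g \<in> Hom C y x" "g \<cdot> f = Ident C x" "f \<cdot> g = Ident C y"
  using assms by (auto simp: is_iso_def Hom_def)

lemma epi_if_iso:
  assumes "is_iso C e" "e \<in> Hom C x y" "u \<in> Hom C y z" "v \<in> Hom C y z" "u \<cdot> e = v \<cdot> e"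
  shows "u = v"
proof -
  obtain e' where e': "e' \<in> Hom C y x" "e \<cdot> e' = Ident C y"
    using isoE assms(1,2) by blast
  have "u = u \<cdot> e \<cdot> e'"
    using comp_assoc[OF assms(3,2) e'(1)] comp_ident[OF assms(3)] e'(2) by simp
  also have "\<dots> = v"
    using comp_assoc[OF assms(4,2) e'(1)] comp_ident[OF assms(4)] e'(2) assms(5) by simp
  finally show ?thesis .
qed

lemma mono_if_iso:
  assumes "is_iso C e" "e \<in> Hom C y z" "u \<in> Hom C x y" "v \<in> Hom C x y" "e \<cdot> u = e \<cdot> v"
  shows "u = v"
proof -
  obtain e' where e': "e' \<in> Hom C z y" "e' \<cdot> e = Ident C y"
    using isoE assms(1,2) by blast
  have "u = e' \<cdot> (e \<cdot> u)"
    using comp_assoc[OF e'(1) assms(2,3)] ident_comp[OF assms(3)] e'(2) by simp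
  also have "\<dots> = v"
    using comp_assoc[OF e'(1) assms(2,4)] ident_comp[OF assms(4)] e'(2) assms(5) by simp
  finally show ?thesis .
qed

lemma Slice_homE:
  assumes "f \<in> Hom (Slice C x) p q"
  obtains k where "f = (p, q, k)" "k \<in> Hom C (Dom C p) (Dom C q)" "q \<cdot> k = p"
    and "p \<in> Hom C (Dom C p) x" "q \<in> Hom C (Dom C q) x"
  using assms by (auto simp: Slice_def Hom_def)

lemma Slice_homI:
  assumes "k \<in> Hom C (Dom C p) (Dom C q)" "q \<cdot> k = p" "p \<in> Hom C (Dom C p) x" "q \<in> Hom C (Dom C q) x"
  shows "(p, q, k) \<in> Hom (Slice C x) p q"
  using assms by (auto simp: Slice_def Hom_def)

lemma Slice_comp: "(q, r, l) \<cdot>\<^bsub>Slice C x\<^esub> (p, q, k) = (p, r, l \<cdot> k)"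
  by (simp add: Slice_def)

lemma Slice_ident: "Ident (Slice C x) p = (p, p, Ident C (Dom C p))"
  by (simp add: Slice_def)

lemma category_Slice: "category (Slice C x)"
proof
  fix f g h w y z t
  show "f \<in> Arr (Slice C x) \<Longrightarrow> Dom (Slice C x) f \<in> Obj (Slice C x)"
    and "f \<in> Arr (Slice C x) \<Longrightarrow> Cod (Slice C x) f \<in> Obj (Slice C x)"
    by (auto simp: Slice_def)
  show "Ident (Slice C x) y \<in> Hom (Slice C x) y y" if "y \<in> Obj (Slice C x)"
  proof -
    have "y \<in> Hom C (Dom C y) x" using that by (simp add: Slice_def Hom_def)
    then show ?thesis
      unfolding Slice_ident using ident_hom homD comp_ident by (blast intro: Slice_homI)
  qed
  show "f \<cdot>\<^bsub>Slice C x\<^esub> Ident (Slice C x) y = f" "Ident (Slice C x) z \<cdot>\<^bsub>Slice C x\<^esub> f = f"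
    if "f \<in> Hom (Slice C x) y z"
    using that by (auto elim!: Slice_homE simp: Slice_ident Slice_comp intro: comp_ident ident_comp)
  assume g: "g \<in> Hom (Slice C x) y z" and f: "f \<in> Hom (Slice C x) w y"
  obtain k where k: "g = (y, z, k)" "k \<in> Hom C (Dom C y) (Dom C z)" "z \<cdot> k = y"
    and z: "z \<in> Hom C (Dom C z) x"
    using g by (rule Slice_homE)
  obtain l where l: "f = (w, y, l)" "l \<in> Hom C (Dom C w) (Dom C y)" "y \<cdot> l = w"
    and w: "w \<in> Hom C (Dom C w) x"
    using f by (rule Slice_homE)
  show "g \<cdot>\<^bsub>Slice C x\<^esub> f \<in> Hom (Slice C x) w z"
    unfolding k(1) l(1) Slice_comp using comp_assoc[OF z k(2) l(2)] k(3) l(3)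
    by (intro Slice_homI comp_hom[OF k(2) l(2)] w z) simp
  show "h \<cdot>\<^bsub>Slice C x\<^esub> g \<cdot>\<^bsub>Slice C x\<^esub> f = h \<cdot>\<^bsub>Slice C x\<^esub> (g \<cdot>\<^bsub>Slice C x\<^esub> f)"
    if h: "h \<in> Hom (Slice C x) z t"
    by (rule Slice_homE[OF h]) (simp add: k(1) l(1) Slice_comp comp_assoc[OF _ k(2) l(2)])
qed

end

section \<open>Products of categories\<close>

text \<open>Membership in \<open>Obj\<close> makes \<open>x\<close> and \<open>y\<close>
  extensional. \<open>Dom\<close> and \<open>Cod\<close> of \<open>Prod_cat\<close> are restrictions
  to \<open>I\<close>, so comparing them with \<open>x\<close> and \<open>y\<close> then reduces to
  comparing components.\<close>

lemma Hom_Prod_cat: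
  assumes "x \<in> Obj (Prod_cat I D)" "y \<in> Obj (Prod_cat I D)"
  shows "Hom (Prod_cat I D) x y = (\<Pi>\<^sub>E i \<in> I. Hom (D i) (x i) (y i))"
proof -
  have eq: "(\<lambda>i\<in>I. u i) = z \<longleftrightarrow> (\<forall>i\<in>I. u i = z i)" if "z \<in> Obj (Prod_cat I D)" for u z
    using that by (auto simp: Prod_cat_def PiE_iff extensional_def restrict_def fun_eq_iff)
  have "f \<in> Hom (Prod_cat I D) x y \<longleftrightarrow> f \<in> (\<Pi>\<^sub>E i \<in> I. Arr (D i)) \<and>
      (\<lambda>i\<in>I. Dom (D i) (f i)) = x \<and> (\<lambda>i\<in>I. Cod (D i) (f i)) = y" for f
    by (auto simp add: Prod_cat_def Hom_def)
  then have "f \<in> Hom (Prod_cat I D) x y \<longleftrightarrow> f \<in> (\<Pi>\<^sub>E i \<in> I. Hom (D i) (x i) (y i))" for f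
    unfolding eq[OF assms(1)] eq[OF assms(2)] by (auto simp: Hom_def PiE_iff)
  then show ?thesis by blast
qed

lemma category_Prod_cat:
  assumes D: "\<And>i. i \<in> I \<Longrightarrow> category (D i)"
  shows "category (Prod_cat I D)"
proof -
  let ?P = "Prod_cat I D"
  have ob: "Dom ?P f \<in> Obj ?P" "Cod ?P f \<in> Obj ?P" if "f \<in> Arr ?P" for f
    using that category.dom_obj[OF D] category.cod_obj[OF D] by (auto simp: Prod_cat_def PiE_iff)
  have H: "x \<in> Obj ?P \<and> y \<in> Obj ?P \<and> f \<in> (\<Pi>\<^sub>E i \<in> I. Hom (D i) (x i) (y i))"
    if "f \<in> Hom ?P x y" for f x y
  proof -
    have "x \<in> Obj ?P" "y \<in> Obj ?P"
      using that ob by (auto simp: Hom_def)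
    then show ?thesis
      using that Hom_Prod_cat by blast
  qed
  have ext: "(\<lambda>i\<in>I. u i) = v" if "v \<in> extensional I" "\<And>i. i \<in> I \<Longrightarrow> u i = v i" for u v
    using that by (auto simp: extensional_def)
  have C: "g \<cdot>\<^bsub>?P\<^esub> f = (\<lambda>i\<in>I. g i \<cdot>\<^bsub>D i\<^esub> f i)" for g f
    by (simp add: Prod_cat_def)
  have J: "Ident ?P x = (\<lambda>i\<in>I. Ident (D i) (x i))" for x
    by (simp add: Prod_cat_def)
  have O: "x i \<in> Obj (D i)" if "x \<in> Obj ?P" "i \<in> I" for x i
    using that by (auto simp: Prod_cat_def)
  show ?thesis
  proof
    fix f g h x y z t
    show "f \<in> Arr ?P \<Longrightarrow> Dom ?P f \<in> Obj ?P" and "f \<in> Arr ?P \<Longrightarrow> Cod ?P f \<in> Obj ?P"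
      using ob by auto
    show "x \<in> Obj ?P \<Longrightarrow> Ident ?P x \<in> Hom ?P x x"
      using category.ident_hom[OF D] O by (auto simp: Hom_Prod_cat J)
    show "g \<cdot>\<^bsub>?P\<^esub> f \<in> Hom ?P x z" if "g \<in> Hom ?P y z" "f \<in> Hom ?P x y"
    proof -
      have "g i \<cdot>\<^bsub>D i\<^esub> f i \<in> Hom (D i) (x i) (z i)" if "i \<in> I" for i
        using category.comp_hom[OF D] H[OF \<open>g \<in> _\<close>] H[OF \<open>f \<in> _\<close>] that by (meson PiE_mem)
      then show ?thesis
        using H[OF \<open>g \<in> _\<close>] H[OF \<open>f \<in> _\<close>] by (simp add: Hom_Prod_cat C)
    qed
    show "f \<cdot>\<^bsub>?P\<^esub> Ident ?P x = f" if "f \<in> Hom ?P x y"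
      unfolding C J using H[OF that] category.comp_ident[OF D]
      by (intro ext) (auto simp: PiE_iff)
    show "Ident ?P y \<cdot>\<^bsub>?P\<^esub> f = f" if "f \<in> Hom ?P x y"
      unfolding C J using H[OF that] category.ident_comp[OF D]
      by (intro ext) (auto simp: PiE_iff)
    show "h \<cdot>\<^bsub>?P\<^esub> g \<cdot>\<^bsub>?P\<^esub> f = h \<cdot>\<^bsub>?P\<^esub> (g \<cdot>\<^bsub>?P\<^esub> f)"
      if "h \<in> Hom ?P z t" "g \<in> Hom ?P y z" "f \<in> Hom ?P x y"
      unfolding C using H[OF that(1)] H[OF that(2)] H[OF that(3)]
      by (intro restrict_ext) (auto simp: PiE_iff intro: category.comp_assoc[OF D])
  qed
qed

section \<open>Fullness of equivalences\<close>

lemma functor_hom: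
  assumes "is_functor C D Fo Fa" "f \<in> Hom C x y"
  shows "Fa f \<in> Hom D (Fo x) (Fo y)"
  using assms by (auto simp: is_functor_def Hom_def)

text \<open>Naturality and invertibility of the unit produce a \<open>g\<close> with
  \<open>Ga (Fa g) = Ga h\<close>. The counit in turn makes \<open>Ga\<close> injective on arrows
  from \<open>Fo p\<close> to \<open>Fo q\<close>, so \<open>Fa g = h\<close>.\<close>

lemma equivalence_full:
  assumes C: "category C" and D: "category D" and eq: "is_equivalence C D Fo Fa"
    and p: "p \<in> Obj C" and q: "q \<in> Obj C" and h: "h \<in> Hom D (Fo p) (Fo q)"
  obtains g where "g \<in> Hom C p q" "Fa g = h"
proof -
  interpret C: category C by fact
  interpret D: category D by fact
  obtain Go Ga \<eta> \<epsilon> where F: "is_functor C D Fo Fa" and G: "is_functor D C Go Ga"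
    and eta: "is_natural_iso C C (\<lambda>x. x) (\<lambda>f. f) (\<lambda>x. Go (Fo x)) (\<lambda>f. Ga (Fa f)) \<eta>"
    and eps: "is_natural_iso D D (\<lambda>y. Fo (Go y)) (\<lambda>g. Fa (Ga g)) (\<lambda>y. y) (\<lambda>g. g) \<epsilon>"
    using eq unfolding is_equivalence_def by auto
  have ep: "\<eta> p \<in> Hom C p (Go (Fo p))" "is_iso C (\<eta> p)"
    and eq: "\<eta> q \<in> Hom C q (Go (Fo q))" "is_iso C (\<eta> q)"
    using eta p q by (auto simp: is_natural_iso_def)
  obtain e' where e': "e' \<in> Hom C (Go (Fo q)) q" "\<eta> q \<cdot>\<^bsub>C\<^esub> e' = Ident C (Go (Fo q))"
    using C.isoE eq by blast
  have Gh: "Ga h \<in> Hom C (Go (Fo p)) (Go (Fo q))"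
    using functor_hom[OF G h] .
  \<comment> \<open>The arrow that solves \<open>\<eta> q \<cdot> g = Ga h \<cdot> \<eta> p\<close>,
    with \<open>e'\<close> inverting \<open>\<eta> q\<close>.\<close>
  define g where "g = e' \<cdot>\<^bsub>C\<^esub> (Ga h \<cdot>\<^bsub>C\<^esub> \<eta> p)"
  have Ghe: "Ga h \<cdot>\<^bsub>C\<^esub> \<eta> p \<in> Hom C p (Go (Fo q))"
    using C.comp_hom[OF Gh ep(1)] .
  have g: "g \<in> Hom C p q"
    unfolding g_def using C.comp_hom[OF e'(1) Ghe] .
  have "Ga (Fa g) \<cdot>\<^bsub>C\<^esub> \<eta> p = \<eta> q \<cdot>\<^bsub>C\<^esub> g"
    using eta C.homD[OF g] unfolding is_natural_iso_def by metis
  also have "\<dots> = Ga h \<cdot>\<^bsub>C\<^esub> \<eta> p"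
    unfolding g_def using C.comp_assoc[OF eq(1) e'(1) Ghe] e'(2) C.ident_comp[OF Ghe] by simp
  finally have "Ga (Fa g) \<cdot>\<^bsub>C\<^esub> \<eta> p = Ga h \<cdot>\<^bsub>C\<^esub> \<eta> p" .
  then have GG: "Ga (Fa g) = Ga h"
    using C.epi_if_iso[OF ep(2,1) _ Gh] functor_hom[OF G functor_hom[OF F g]] by blast
  have Fp: "Fo p \<in> Obj D"
    using F p by (auto simp: is_functor_def)
  have e: "\<epsilon> (Fo p) \<in> Hom D (Fo (Go (Fo p))) (Fo p)" "is_iso D (\<epsilon> (Fo p))"
    using eps Fp by (auto simp: is_natural_iso_def)
  \<comment> \<open>The right-hand side depends on \<open>u\<close> only through
    \<open>Ga u\<close>. As \<open>\<epsilon> (Fo p)\<close> is epic, \<open>Ga u\<close> therefore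
    determines \<open>u\<close>.\<close>
  have nat: "u \<cdot>\<^bsub>D\<^esub> \<epsilon> (Fo p) = \<epsilon> (Fo q) \<cdot>\<^bsub>D\<^esub> Fa (Ga u)" if u: "u \<in> Hom D (Fo p) (Fo q)" for u
  proof -
    have "u \<cdot>\<^bsub>D\<^esub> \<epsilon> (Dom D u) = \<epsilon> (Cod D u) \<cdot>\<^bsub>D\<^esub> Fa (Ga u)"
      using eps D.homD[OF u] unfolding is_natural_iso_def by blast
    then show ?thesis using D.homD[OF u] by simp
  qed
  have "Fa g \<cdot>\<^bsub>D\<^esub> \<epsilon> (Fo p) = h \<cdot>\<^bsub>D\<^esub> \<epsilon> (Fo p)"
    unfolding nat[OF functor_hom[OF F g]] GG by (rule nat[OF h, symmetric])
  then have "Fa g = h"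
    by (rule D.epi_if_iso[OF e(2,1) functor_hom[OF F g] h])
  with g that show thesis by blast
qed

section \<open>Coproducts and initial objects\<close>

definition is_initial :: "('o, 'm, 'r) cat_scheme \<Rightarrow> 'o \<Rightarrow> bool"
  where "is_initial C z \<longleftrightarrow> z \<in> Obj C \<and> (\<forall>t \<in> Obj C. \<exists>!u. u \<in> Hom C z t)"

context category
begin

lemma coproduct_objs:
  assumes "is_coproduct C I X s \<iota>"
  shows "s \<in> Obj C" "\<And>i. i \<in> I \<Longrightarrow> \<iota> i \<in> Hom C (X i) s"
  using assms by (auto simp: is_coproduct_def)

lemma coproduct_eqI:
  assumes cop: "is_coproduct C I X s \<iota>" and u: "u \<in> Hom C s t" and v: "v \<in> Hom C s t"
    and eq: "\<And>i. i \<in> I \<Longrightarrow> u \<cdot> \<iota> i = v \<cdot> \<iota> i"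
  shows "u = v"
proof -
  have "t \<in> Obj C" using homD[OF u] by blast
  \<comment> \<open>The cocone is the one induced by \<open>v\<close>; both \<open>u\<close> and
    \<open>v\<close> mediate it.\<close>
  moreover have "\<forall>i\<in>I. v \<cdot> \<iota> i \<in> Hom C (X i) t"
    using comp_hom[OF v] cop by (auto simp: is_coproduct_def)
  moreover have "\<forall>t \<in> Obj C. \<forall>g. (\<forall>i \<in> I. g i \<in> Hom C (X i) t) \<longrightarrow>
      (\<exists>!u. u \<in> Hom C s t \<and> (\<forall>i \<in> I. u \<cdot> \<iota> i = g i))"
    using cop by (simp add: is_coproduct_def)
  ultimately have "\<exists>!u. u \<in> Hom C s t \<and> (\<forall>i\<in>I. u \<cdot> \<iota> i = v \<cdot> \<iota> i)"
    by simp
  then show ?thesis using u v eq by blast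
qed

lemma coproduct_factor:
  assumes "is_coproduct C I X s \<iota>" "t \<in> Obj C" "\<And>i. i \<in> I \<Longrightarrow> g i \<in> Hom C (X i) t"
  obtains u where "u \<in> Hom C s t" "\<And>i. i \<in> I \<Longrightarrow> u \<cdot> \<iota> i = g i"
proof -
  have "\<exists>!u. u \<in> Hom C s t \<and> (\<forall>i\<in>I. u \<cdot> \<iota> i = g i)"
    using assms unfolding is_coproduct_def by blast
  then show thesis using that by blast
qed

text \<open>Existence of a common lift through \<open>p\<close> and \<open>q\<close> is local on a
  coproduct: lifts chosen on the summands induce one arrow, and the two equations need checking only
  on the injections. The existence half of the pullback property is reduced to pieces in this
  way.\<close>

lemma coproduct_lift_glue:
  assumes cop: "is_coproduct C I X s \<iota>"
    and p: "p \<in> Hom C w y" and q: "q \<in> Hom C w z" and r: "r \<in> Hom C s y" and t: "t \<in> Hom C s z"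
    and loc: "\<And>i. i \<in> I \<Longrightarrow> \<exists>n \<in> Hom C (X i) w. p \<cdot> n = r \<cdot> \<iota> i \<and> q \<cdot> n = t \<cdot> \<iota> i"
  shows "\<exists>n \<in> Hom C s w. p \<cdot> n = r \<and> q \<cdot> n = t"
proof -
  obtain n where n: "\<And>i. i \<in> I \<Longrightarrow> n i \<in> Hom C (X i) w \<and> p \<cdot> n i = r \<cdot> \<iota> i \<and> q \<cdot> n i = t \<cdot> \<iota> i"
    using loc by metis
  have w: "w \<in> Obj C" using homD[OF p] by blast
  obtain u where u: "u \<in> Hom C s w" "\<And>i. i \<in> I \<Longrightarrow> u \<cdot> \<iota> i = n i"
    using coproduct_factor[OF cop w] n by metis
  note \<iota> = coproduct_objs(2)[OF cop]
  have "p \<cdot> u = r"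
    by (rule coproduct_eqI[OF cop comp_hom[OF p u(1)] r])
      (use comp_assoc[OF p u(1) \<iota>] u n in simp)
  moreover have "q \<cdot> u = t"
    by (rule coproduct_eqI[OF cop comp_hom[OF q u(1)] t])
      (use comp_assoc[OF q u(1) \<iota>] u n in simp)
  ultimately show ?thesis using u(1) by blast
qed

text \<open>A mediating arrow \<open>u\<close> out of \<open>s\<close> becomes
  \<open>u \<cdot> e'\<close> out of \<open>t\<close>, where \<open>e'\<close> inverts
  \<open>e\<close>; uniqueness carries over because \<open>e\<close> is epic. This moves a coproduct
  structure onto an object given in advance.\<close>

lemma coproduct_iso:
  assumes cop: "is_coproduct C I X s \<iota>" and e: "e \<in> Hom C s t" "is_iso C e"
  shows "is_coproduct C I X t (\<lambda>i. e \<cdot> \<iota> i)"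
  unfolding is_coproduct_def
proof (intro conjI ballI allI impI)
  note \<iota> = coproduct_objs(2)[OF cop]
  show "t \<in> Obj C" using homD[OF e(1)] by blast
  show "e \<cdot> \<iota> i \<in> Hom C (X i) t" if "i \<in> I" for i
    using comp_hom[OF e(1) \<iota>[OF that]] .
  fix y g assume y: "y \<in> Obj C" and g: "\<forall>i\<in>I. g i \<in> Hom C (X i) y"
  obtain u where u: "u \<in> Hom C s y" "\<And>i. i \<in> I \<Longrightarrow> u \<cdot> \<iota> i = g i"
    using coproduct_factor[OF cop y] g by metis
  obtain e' where e': "e' \<in> Hom C t s" "e' \<cdot> e = Ident C s"
    using isoE e by blast
  have ue: "u \<cdot> e' \<in> Hom C t y" using comp_hom u(1) e'(1) .
  have "u \<cdot> e' \<cdot> e = u"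
    using comp_assoc[OF u(1) e'(1) e(1)] e'(2) comp_ident[OF u(1)] by simp
  then have "u \<cdot> e' \<cdot> (e \<cdot> \<iota> i) = g i" if "i \<in> I" for i
    using comp_assoc[OF ue e(1) \<iota>[OF that]] u(2)[OF that] by simp
  moreover have "v = v'" if v: "v \<in> Hom C t y" "v' \<in> Hom C t y"
    and "\<forall>i\<in>I. v \<cdot> (e \<cdot> \<iota> i) = g i" "\<forall>i\<in>I. v' \<cdot> (e \<cdot> \<iota> i) = g i" for v v'
  proof (rule epi_if_iso[OF e(2,1) v], rule coproduct_eqI[OF cop])
    show "v \<cdot> e \<in> Hom C s y" "v' \<cdot> e \<in> Hom C s y"
      using comp_hom v e(1) by blast+
    show "v \<cdot> e \<cdot> \<iota> i = v' \<cdot> e \<cdot> \<iota> i" if "i \<in> I" for i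
      using comp_assoc[OF v(1) e(1) \<iota>] comp_assoc[OF v(2) e(1) \<iota>] that \<open>\<forall>i\<in>I. v \<cdot> _ = _\<close>
        \<open>\<forall>i\<in>I. v' \<cdot> _ = _\<close> by simp
  qed
  ultimately show "\<exists>!u. u \<in> Hom C t y \<and> (\<forall>i\<in>I. u \<cdot> (e \<cdot> \<iota> i) = g i)"
    using ue by blast
qed

lemma initial_obj: "is_initial C z \<Longrightarrow> z \<in> Obj C"
  by (simp add: is_initial_def)

lemma initial_arr: "is_initial C z \<Longrightarrow> t \<in> Obj C \<Longrightarrow> \<exists>u. u \<in> Hom C z t"
  unfolding is_initial_def by blast

lemma initial_eq:
  assumes "is_initial C z" "u \<in> Hom C z t" "v \<in> Hom C z t"
  shows "u = v"
  using assms homD[OF assms(2)] by (auto simp: is_initial_def)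

lemma initial_if_empty_coproduct: "is_coproduct C {} X s \<iota> \<Longrightarrow> is_initial C s"
  by (simp add: is_coproduct_def is_initial_def)

text \<open>The inverse is induced by the identity on \<open>X i\<close> and the unique arrows to
  \<open>X i\<close> from the other, initial, summands. One composite is the identity by
  construction, the other by comparison on every injection.\<close>

lemma coproduct_inj_iso:
  assumes cop: "is_coproduct C I X s \<iota>" and i: "i \<in> I" and Xi: "X i \<in> Obj C"
    and init: "\<And>j. j \<in> I \<Longrightarrow> j \<noteq> i \<Longrightarrow> is_initial C (X j)"
  shows "is_iso C (\<iota> i)"
proof -
  note \<iota> = coproduct_objs(2)[OF cop]
  \<comment> \<open>The implication forces the later choice of \<open>g\<close> to be the identity
    at \<open>i\<close>.\<close>
  have "\<exists>g. g \<in> Hom C (X j) (X i) \<and> (j = i \<longrightarrow> g = Ident C (X i))" if "j \<in> I" for j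
    using ident_hom[OF Xi] initial_arr[OF init[OF that] Xi] by (cases "j = i") auto
  then obtain g where g: "\<And>j. j \<in> I \<Longrightarrow> g j \<in> Hom C (X j) (X i)" "g i = Ident C (X i)"
    using i by metis
  obtain u where u: "u \<in> Hom C s (X i)" "\<And>j. j \<in> I \<Longrightarrow> u \<cdot> \<iota> j = g j"
    using coproduct_factor[OF cop Xi] g(1) by metis
  have s: "Ident C s \<in> Hom C s s"
    using ident_hom coproduct_objs(1)[OF cop] .
  have iu: "\<iota> i \<cdot> u \<in> Hom C s s" using comp_hom[OF \<iota>[OF i] u(1)] .
  have "\<iota> i \<cdot> u = Ident C s"
  proof (rule coproduct_eqI[OF cop iu s])
    fix j assume j: "j \<in> I"
    show "\<iota> i \<cdot> u \<cdot> \<iota> j = Ident C s \<cdot> \<iota> j"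
    proof (cases "j = i")
      case True
      then show ?thesis
        using comp_assoc[OF \<iota>[OF i] u(1) \<iota>[OF i]] u(2)[OF i] g(2) comp_ident[OF \<iota>[OF i]]
          ident_comp[OF \<iota>[OF i]] by simp
    next
      case False
      then show ?thesis
        using initial_eq[OF init[OF j]] comp_hom[OF iu \<iota>[OF j]] comp_hom[OF s \<iota>[OF j]] by blast
    qed
  qed
  then show ?thesis
    using u(1) u(2)[OF i] g(2) \<iota>[OF i] by (auto simp: is_iso_def Hom_def)
qed

end

section \<open>Morphisms induced between the chosen coproducts\<close>

context category_with_small_coproducts
begin

lemma inj_hom: "X \<in> I \<rightarrow>\<^sub>E Obj C \<Longrightarrow> i \<in> I \<Longrightarrow> Inj C I X i \<in> Hom C (X i) (Coprod C I X)"
  by (rule coproduct_objs(2)[OF coproduct])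

text \<open>\<open>fam_sum\<close> is a definite description. The universal property, applied to the
  cocone \<open>Inj C J d (f i) \<cdot> fh i\<close>, supplies the unique existence that makes it
  meaningful.\<close>

lemma fam_sum:
  assumes c: "c \<in> I \<rightarrow>\<^sub>E Obj C" and d: "d \<in> J \<rightarrow>\<^sub>E Obj C" and f: "f \<in> I \<rightarrow> J"
    and fh: "fh \<in> (\<Pi> i \<in> I. Hom C (c i) (d (f i)))"
  shows "fam_sum C ((I, c), (J, d), f, fh) \<in> Hom C (Coprod C I c) (Coprod C J d)"
    and "\<And>i. i \<in> I \<Longrightarrow>
      fam_sum C ((I, c), (J, d), f, fh) \<cdot> Inj C I c i = Inj C J d (f i) \<cdot> fh i"
proof -
  have "\<exists>!u. u \<in> Hom C (Coprod C I c) (Coprod C J d) \<and>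
      (\<forall>i \<in> I. u \<cdot> Inj C I c i = Inj C J d (f i) \<cdot> fh i)"
  proof -
    have "\<forall>i \<in> I. Inj C J d (f i) \<cdot> fh i \<in> Hom C (c i) (Coprod C J d)"
      using comp_hom[OF inj_hom[OF d]] f fh by (auto simp: Pi_iff)
    moreover have "\<forall>t \<in> Obj C. \<forall>g. (\<forall>i \<in> I. g i \<in> Hom C (c i) t) \<longrightarrow>
        (\<exists>!u. u \<in> Hom C (Coprod C I c) t \<and> (\<forall>i \<in> I. u \<cdot> Inj C I c i = g i))"
      using coproduct[OF c] by (simp add: is_coproduct_def)
    ultimately show ?thesis
      using coproduct_objs(1)[OF coproduct[OF d]] by simp
  qed
  from theI'[OF this]
  show "fam_sum C ((I, c), (J, d), f, fh) \<in> Hom C (Coprod C I c) (Coprod C J d)"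
    and "\<And>i. i \<in> I \<Longrightarrow>
      fam_sum C ((I, c), (J, d), f, fh) \<cdot> Inj C I c i = Inj C J d (f i) \<cdot> fh i"
    unfolding fam_sum_def by auto
qed

text \<open>The pieces of a split object reach a coproduct through a single injection. On such
  arrows the induced morphism can be computed on the index and on the component separately.\<close>

lemma fam_sum_comp_inj:
  assumes "c \<in> I \<rightarrow>\<^sub>E Obj C" "d \<in> J \<rightarrow>\<^sub>E Obj C" "f \<in> I \<rightarrow> J"
    and "fh \<in> (\<Pi> i \<in> I. Hom C (c i) (d (f i)))"
    and i: "i \<in> I" and n: "n \<in> Hom C u (c i)"
  shows "fam_sum C ((I, c), (J, d), f, fh) \<cdot> (Inj C I c i \<cdot> n) = Inj C J d (f i) \<cdot> (fh i \<cdot> n)"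
proof -
  have f: "f i \<in> J" using assms by auto
  note F = fam_sum[OF assms(1-4)]
  show ?thesis
    using comp_assoc[OF F(1) inj_hom[OF assms(1) i] n] F(2)[OF i]
      comp_assoc[OF inj_hom[OF assms(2) f] Pi_mem[OF assms(4) i] n] by simp
qed

text \<open>The domains are named by an extensional family \<open>P\<close>, which equals the
  restricted family of domains in the definition; the source of the sum is then literally
  \<open>Coprod C I P\<close>.\<close>

lemma slice_sum_obj:
  assumes P: "P \<in> I \<rightarrow>\<^sub>E Obj C" and X: "X \<in> I \<rightarrow>\<^sub>E Obj C"
    and p: "p \<in> (\<Pi> i \<in> I. Hom C (P i) (X i))"
  shows "slice_sum_obj C I X p \<in> Hom C (Coprod C I P) (Coprod C I X)"
    and "\<And>i. i \<in> I \<Longrightarrow> slice_sum_obj C I X p \<cdot> Inj C I P i = Inj C I X i \<cdot> p i"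
proof -
  have "(\<lambda>i\<in>I. Dom C (p i)) = P"
    using P p homD by (force simp: PiE_iff extensional_def)
  then have "slice_sum_obj C I X p = fam_sum C ((I, P), (I, X), \<lambda>i\<in>I. i, p)"
    by (simp add: slice_sum_obj_def)
  then show "slice_sum_obj C I X p \<in> Hom C (Coprod C I P) (Coprod C I X)"
    and "\<And>i. i \<in> I \<Longrightarrow> slice_sum_obj C I X p \<cdot> Inj C I P i = Inj C I X i \<cdot> p i"
    using fam_sum[OF P X, of "\<lambda>i\<in>I. i" p] p by (auto simp: Pi_iff)
qed

end

section \<open>Consequences of extensivity: splitting, strictness, and monic disjoint
  injections\<close>

context extensive_category
begin

text \<open>This is essential surjectivity of the sum functor. The counit at \<open>p\<close> is an
  isomorphism over \<open>Coprod C I X\<close> from a sum of objects over the \<open>X i\<close> to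
  \<open>p\<close>; along its underlying arrow the coproduct structure is carried to
  \<open>t\<close>.\<close>

lemma decompose_over_coproduct:
  assumes X: "X \<in> I \<rightarrow>\<^sub>E Obj C" and p: "p \<in> Hom C t (Coprod C I X)"
  obtains T \<iota> \<pi> where "is_coproduct C I T t \<iota>"
    and "\<And>i. i \<in> I \<Longrightarrow> \<pi> i \<in> Hom C (T i) (X i)"
    and "\<And>i. i \<in> I \<Longrightarrow> p \<cdot> \<iota> i = Inj C I X i \<cdot> \<pi> i"
proof -
  let ?S = "Slice C (Coprod C I X)" and ?P = "Prod_cat I (\<lambda>i. Slice C (X i))"
  obtain Go Ga \<epsilon> where G: "is_functor ?S ?P Go Ga"
    and eps: "is_natural_iso ?S ?S (\<lambda>y. slice_sum_obj C I X (Go y))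
      (\<lambda>g. slice_sum_arr C I X (Ga g)) (\<lambda>y. y) (\<lambda>g. g) \<epsilon>"
    using extensive[OF X] unfolding is_equivalence_def by auto
  have "p \<in> Obj ?S" using p by (simp add: Slice_def Hom_def)
  then have Gp: "Go p \<in> Obj ?P"
    and e: "\<epsilon> p \<in> Hom ?S (slice_sum_obj C I X (Go p)) p" "is_iso ?S (\<epsilon> p)"
    using G eps by (auto simp: is_functor_def is_natural_iso_def)
  \<comment> \<open>The pieces of \<open>t\<close> are the domains of the components of
    \<open>Go p\<close>, and these components are the projections \<open>\<pi>\<close>.\<close>
  define T where "T = (\<lambda>i\<in>I. Dom C (Go p i))"
  have T: "T \<in> I \<rightarrow>\<^sub>E Obj C"
    using Gp dom_obj by (auto simp: T_def Prod_cat_def Slice_def PiE_iff)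
  have \<pi>: "Go p \<in> (\<Pi> i \<in> I. Hom C (T i) (X i))"
    using Gp by (auto simp: T_def Prod_cat_def Slice_def PiE_iff Hom_def)
  note F = slice_sum_obj[OF T X \<pi>]
  obtain e where e': "\<epsilon> p = (slice_sum_obj C I X (Go p), p, e)"
    and e_hom: "e \<in> Hom C (Coprod C I T) t" and pe: "p \<cdot> e = slice_sum_obj C I X (Go p)"
    using e(1) F(1) p by (auto simp: Slice_def Hom_def)
  interpret S: category ?S by (rule category_Slice)
  obtain k where k: "k \<in> Hom ?S p (slice_sum_obj C I X (Go p))"
    "k \<cdot>\<^bsub>?S\<^esub> \<epsilon> p = Ident ?S (slice_sum_obj C I X (Go p))" "\<epsilon> p \<cdot>\<^bsub>?S\<^esub> k = Ident ?S p"
    using S.isoE[OF e(2,1)] .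
  \<comment> \<open>An inverse in the slice has an underlying arrow \<open>e2\<close>, which inverts
    \<open>e\<close> in \<open>C\<close>.\<close>
  obtain e2 where "k = (p, slice_sum_obj C I X (Go p), e2)"
    and "e2 \<in> Hom C t (Coprod C I T)"
    using k(1) F(1) p by (auto simp: Slice_def Hom_def)
  moreover from this have "e2 \<cdot> e = Ident C (Coprod C I T)" "e \<cdot> e2 = Ident C t"
    using k(2,3) F(1) p by (auto simp: e' Slice_def Hom_def)
  ultimately have "is_iso C e"
    using e_hom by (auto simp: is_iso_def Hom_def)
  then have "is_coproduct C I T t (\<lambda>i. e \<cdot> Inj C I T i)"
    by (rule coproduct_iso[OF coproduct[OF T] e_hom])
  moreover have "p \<cdot> (e \<cdot> Inj C I T i) = Inj C I X i \<cdot> Go p i" if "i \<in> I" for i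
    using comp_assoc[OF p e_hom inj_hom[OF T that]] pe F(2)[OF that] by simp
  ultimately show thesis using that Pi_mem[OF \<pi>] by blast
qed

text \<open>An arrow to \<open>z\<close> extends to one into the empty coproduct. Splitting
  \<open>t\<close> along it exhibits \<open>t\<close> as a coproduct of the empty family.\<close>

lemma strict_initial:
  assumes z: "is_initial C z" and p: "p \<in> Hom C t z"
  shows "is_initial C t"
proof -
  \<comment> \<open>The only extensional function on the empty index set.\<close>
  let ?X = "\<lambda>i. undefined"
  have X: "?X \<in> {} \<rightarrow>\<^sub>E Obj C" by auto
  have "Coprod C {} ?X \<in> Obj C"
    using coproduct_objs(1)[OF coproduct[OF X]] .
  then obtain u where "u \<in> Hom C z (Coprod C {} ?X)"
    using initial_arr[OF z] by blast
  then have "u \<cdot> p \<in> Hom C t (Coprod C {} ?X)" using comp_hom p by blast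
  from decompose_over_coproduct[OF X this] show ?thesis
    using initial_if_empty_coproduct by metis
qed

lemma initial_exists: obtains z where "is_initial C z"
  using initial_if_empty_coproduct coproduct[of "\<lambda>i. undefined" "{}"] by auto

text \<open>Fullness of the sum functor, expressed in \<open>C\<close> instead of in slices. Objects
  of \<open>Prod_cat\<close> are extensional, hence the extensional products for \<open>p\<close>
  and \<open>q\<close>.\<close>

lemma slice_sum_full:
  assumes X: "X \<in> I \<rightarrow>\<^sub>E Obj C" and P: "P \<in> I \<rightarrow>\<^sub>E Obj C" and Q: "Q \<in> I \<rightarrow>\<^sub>E Obj C"
    and p: "p \<in> (\<Pi>\<^sub>E i \<in> I. Hom C (P i) (X i))" and q: "q \<in> (\<Pi>\<^sub>E i \<in> I. Hom C (Q i) (X i))"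
    and e: "e \<in> Hom C (Coprod C I P) (Coprod C I Q)"
    and qe: "slice_sum_obj C I X q \<cdot> e = slice_sum_obj C I X p"
  obtains \<phi> where "\<And>i. i \<in> I \<Longrightarrow> \<phi> i \<in> Hom C (P i) (Q i)"
    and "\<And>i. i \<in> I \<Longrightarrow> q i \<cdot> \<phi> i = p i"
    and "\<And>i. i \<in> I \<Longrightarrow> e \<cdot> Inj C I P i = Inj C I Q i \<cdot> \<phi> i"
proof -
  let ?S = "Slice C (Coprod C I X)" and ?P = "Prod_cat I (\<lambda>i. Slice C (X i))"
  have p': "p \<in> (\<Pi> i \<in> I. Hom C (P i) (X i))"
    and q': "q \<in> (\<Pi> i \<in> I. Hom C (Q i) (X i))"
    using p q by auto
  have obp: "p \<in> Obj ?P" and obq: "q \<in> Obj ?P"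
    using p q by (auto simp: Prod_cat_def Slice_def PiE_iff Hom_def)
  have "(slice_sum_obj C I X p, slice_sum_obj C I X q, e)
      \<in> Hom ?S (slice_sum_obj C I X p) (slice_sum_obj C I X q)"
    using slice_sum_obj(1)[OF P X p'] slice_sum_obj(1)[OF Q X q'] e qe
    by (auto simp: Slice_def Hom_def)
  then obtain \<psi> where \<psi>: "\<psi> \<in> Hom ?P p q"
    and eq: "slice_sum_arr C I X \<psi> = (slice_sum_obj C I X p, slice_sum_obj C I X q, e)"
    using equivalence_full[OF category_Prod_cat[OF category_Slice] category_Slice extensive[OF X]
        obp obq] by blast
  define \<phi> where "\<phi> = (\<lambda>i\<in>I. snd (snd (\<psi> i)))"
  have \<psi>i: "\<psi> i = (p i, q i, \<phi> i) \<and> \<phi> i \<in> Hom C (P i) (Q i) \<and> q i \<cdot> \<phi> i = p i" if "i \<in> I" for i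
  proof -
    have "\<psi> i \<in> Hom (Slice C (X i)) (p i) (q i)"
      using \<psi> that by (auto simp: Hom_Prod_cat[OF obp obq])
    then show ?thesis
      using Pi_mem[OF p' that] Pi_mem[OF q' that] that by (auto simp: \<phi>_def Slice_def Hom_def)
  qed
  \<comment> \<open>\<open>slice_sum_arr\<close> reads the source and target families off
    \<open>\<psi>\<close>; they are identified with \<open>P\<close> and \<open>Q\<close> so that
    \<open>fam_sum\<close> applies.\<close>
  have "(\<lambda>i\<in>I. Dom C ((\<lambda>i\<in>I. fst (\<psi> i)) i)) = P"
    by (rule extensionalityI[of _ I])
      (use P \<psi>i homD[OF Pi_mem[OF p']] in \<open>auto simp: PiE_iff\<close>)
  moreover have "(\<lambda>i\<in>I. Dom C ((\<lambda>i\<in>I. fst (snd (\<psi> i))) i)) = Q"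
    by (rule extensionalityI[of _ I])
      (use Q \<psi>i homD[OF Pi_mem[OF q']] in \<open>auto simp: PiE_iff\<close>)
  ultimately have "e = fam_sum C ((I, P), (I, Q), \<lambda>i\<in>I. i, \<phi>)"
    using eq by (simp add: slice_sum_arr_def Let_def \<phi>_def)
  then have "e \<cdot> Inj C I P i = Inj C I Q i \<cdot> \<phi> i" if "i \<in> I" for i
    using fam_sum(2)[OF P Q, of "\<lambda>i\<in>I. i" \<phi> i] \<psi>i that by (auto simp: Pi_iff)
  with \<psi>i that show thesis by blast
qed

text \<open>An object \<open>t\<close> over \<open>X i\<close> is viewed as the coproduct of the family that is \<open>t\<close> at \<open>i\<close> and
  initial elsewhere.\<close>

lemma concentrated_family:
  assumes X: "X \<in> I \<rightarrow>\<^sub>E Obj C" and i: "i \<in> I" and u: "u \<in> Hom C t (X i)"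
    and z: "is_initial C z"
  defines "P \<equiv> \<lambda>l\<in>I. if l = i then t else z"
  obtains p where "p \<in> (\<Pi>\<^sub>E l \<in> I. Hom C (P l) (X l))" "p i = u"
    and "P \<in> I \<rightarrow>\<^sub>E Obj C" "is_iso C (Inj C I P i)" "Inj C I P i \<in> Hom C t (Coprod C I P)"
    and "slice_sum_obj C I X p \<in> Hom C (Coprod C I P) (Coprod C I X)"
    and "slice_sum_obj C I X p \<cdot> Inj C I P i = Inj C I X i \<cdot> u"
proof -
  have P: "P \<in> I \<rightarrow>\<^sub>E Obj C"
    using homD[OF u] initial_obj[OF z] by (simp add: P_def)
  \<comment> \<open>Away from \<open>i\<close> the choice operator picks an arrow out of the initial
    object \<open>z\<close>.\<close>
  define p where "p = (\<lambda>l\<in>I. if l = i then u else (SOME v. v \<in> Hom C z (X l)))"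
  have "(SOME v. v \<in> Hom C z (X l)) \<in> Hom C z (X l)" if "l \<in> I" for l
    using initial_arr[OF z PiE_mem[OF X that]] by (rule someI_ex)
  then have p: "p \<in> (\<Pi>\<^sub>E l \<in> I. Hom C (P l) (X l))"
    using u by (auto simp: p_def P_def)
  have pi: "p i = u" using i by (simp add: p_def)
  have Pi: "P i = t" using i by (simp add: P_def)
  have iso: "is_iso C (Inj C I P i)"
    by (rule coproduct_inj_iso[OF coproduct[OF P] i]) 
      (use P i z in \<open>auto simp: P_def split: if_splits\<close>)
  have "p \<in> (\<Pi> l \<in> I. Hom C (P l) (X l))" using p by auto
  note F = slice_sum_obj[OF P X this]
  show thesis
    using that[OF p pi P iso _ F(1)] inj_hom[OF P i] F(2)[OF i] pi Pi by simp
qed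

text \<open>Monicity and disjointness of the injections together. Concentrating \<open>t\<close> at
  \<open>i\<close> via \<open>u\<close> and at \<open>j\<close> via \<open>v\<close> gives two
  families whose sums are isomorphic over \<open>Coprod C I X\<close>; fullness turns this
  isomorphism into a family \<open>\<phi>\<close>. If the indices differ, \<open>\<phi> i\<close> is
  an arrow from \<open>t\<close> to \<open>z\<close> and strictness applies; if they agree,
  \<open>\<phi> i\<close> is the identity and \<open>u = v\<close>.\<close>

lemma inj_eq_cases:
  assumes X: "X \<in> I \<rightarrow>\<^sub>E Obj C" and i: "i \<in> I" and j: "j \<in> I"
    and u: "u \<in> Hom C t (X i)" and v: "v \<in> Hom C t (X j)"
    and eq: "Inj C I X i \<cdot> u = Inj C I X j \<cdot> v"
  shows "is_initial C t \<or> i = j \<and> u = v"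
proof -
  obtain z where z: "is_initial C z" by (rule initial_exists)
  let ?P = "\<lambda>l\<in>I. if l = i then t else z" and ?Q = "\<lambda>l\<in>I. if l = j then t else z"
  let ?F = "slice_sum_obj C I X"
  obtain p where p: "p \<in> (\<Pi>\<^sub>E l \<in> I. Hom C (?P l) (X l))" "p i = u"
    and P: "?P \<in> I \<rightarrow>\<^sub>E Obj C" "is_iso C (Inj C I ?P i)" "Inj C I ?P i \<in> Hom C t (Coprod C I ?P)"
    and Fp: "?F p \<in> Hom C (Coprod C I ?P) (Coprod C I X)" "?F p \<cdot> Inj C I ?P i = Inj C I X i \<cdot> u"
    using concentrated_family[OF X i u z] .
  obtain q where q: "q \<in> (\<Pi>\<^sub>E l \<in> I. Hom C (?Q l) (X l))" "q j = v"
    and Q: "?Q \<in> I \<rightarrow>\<^sub>E Obj C" "is_iso C (Inj C I ?Q j)" "Inj C I ?Q j \<in> Hom C t (Coprod C I ?Q)"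
    and Fq: "?F q \<in> Hom C (Coprod C I ?Q) (Coprod C I X)" "?F q \<cdot> Inj C I ?Q j = Inj C I X j \<cdot> v"
    using concentrated_family[OF X j v z] .
  obtain k where k: "k \<in> Hom C (Coprod C I ?P) t" "k \<cdot> Inj C I ?P i = Ident C t"
    "Inj C I ?P i \<cdot> k = Ident C (Coprod C I ?P)"
    using isoE[OF P(2,3)] .
  \<comment> \<open>Both coproducts are copies of \<open>t\<close>; this is the comparison through
    \<open>t\<close>. It lies over \<open>Coprod C I X\<close> because of \<open>eq\<close>.\<close>
  let ?e = "Inj C I ?Q j \<cdot> k"
  have e: "?e \<in> Hom C (Coprod C I ?P) (Coprod C I ?Q)"
    using comp_hom[OF Q(3) k(1)] .
  have "?F q \<cdot> ?e = ?F p \<cdot> Inj C I ?P i \<cdot> k"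
    using comp_assoc[OF Fq(1) Q(3) k(1)] Fq(2) Fp(2) eq by simp
  also have "\<dots> = ?F p"
    using comp_assoc[OF Fp(1) P(3) k(1)] k(3) comp_ident[OF Fp(1)] by simp
  finally obtain \<phi> where \<phi>: "\<And>l. l \<in> I \<Longrightarrow> \<phi> l \<in> Hom C (?P l) (?Q l)"
    "\<And>l. l \<in> I \<Longrightarrow> q l \<cdot> \<phi> l = p l"
    "\<And>l. l \<in> I \<Longrightarrow> ?e \<cdot> Inj C I ?P l = Inj C I ?Q l \<cdot> \<phi> l"
    using slice_sum_full[OF X P(1) Q(1) p(1) q(1) e] by metis
  have \<phi>i: "\<phi> i \<in> Hom C t (?Q i)" using \<phi>(1)[OF i] i by simp
  show ?thesis
  proof (cases "i = j")
    case False
    then have "\<phi> i \<in> Hom C t z" using \<phi>i i by simp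
    then show ?thesis using strict_initial[OF z] by blast
  next
    case True
    have t: "Ident C t \<in> Hom C t t" using ident_hom homD[OF u] by blast
    have "Inj C I ?Q j \<cdot> \<phi> i = Inj C I ?Q j \<cdot> Ident C t"
      using \<phi>(3)[OF i] comp_assoc[OF Q(3) k(1) P(3)] k(2) True by simp
    then have "\<phi> i = Ident C t"
      using mono_if_iso[OF Q(2,3) _ t] \<phi>i True i by simp
    then show ?thesis
      using \<phi>(2)[OF i] p(2) q(2) True comp_ident[OF v] by simp
  qed
qed

end

section \<open>Pullbacks of sets, and joint monicity of pullback legs\<close>

text \<open>Arrows out of a one-point set are elements, so testing the universal property there
  gives unique existence of \<open>w\<close>.\<close>

lemma Set_pullback_unique:
  assumes "is_pullback Set_cat (W, X, f) (W, Y, g) (X, Z, h) (Y, Z, k)"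
  shows "\<And>w. w \<in> W \<Longrightarrow> h (f w) = k (g w)"
    and "\<And>x y. x \<in> X \<Longrightarrow> y \<in> Y \<Longrightarrow> h x = k y \<Longrightarrow> \<exists>!w. w \<in> W \<and> f w = x \<and> g w = y"
proof -
  have fg: "f \<in> W \<rightarrow>\<^sub>E X" "g \<in> W \<rightarrow>\<^sub>E Y"
    and "compose W h f = compose W k g"
    using assms by (auto simp: is_pullback_def Set_cat_def)
  then show "h (f w) = k (g w)" if "w \<in> W" for w
    using that by (metis compose_eq)
  fix x y assume x: "x \<in> X" and y: "y \<in> Y" and eq: "h x = k y"
  \<comment> \<open>Objects of \<open>Set_cat\<close> are subsets of one type, so \<open>{x}\<close>
    serves as the one-point set; \<open>?r\<close> and \<open>?s\<close> pick out \<open>x\<close>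
    and \<open>y\<close>.\<close>
  let ?r = "({x}, X, \<lambda>_\<in>{x}. x)" and ?s = "({x}, Y, \<lambda>_\<in>{x}. y)"
  have "?r \<in> Hom Set_cat {x} X" "?s \<in> Hom Set_cat {x} Y"
    "(X, Z, h) \<cdot>\<^bsub>Set_cat\<^esub> ?r = (Y, Z, k) \<cdot>\<^bsub>Set_cat\<^esub> ?s"
    using x y eq by (auto simp: Set_cat_def Hom_def compose_def)
  moreover have "\<And>t r s. t \<in> Obj Set_cat \<Longrightarrow> r \<in> Hom Set_cat t X \<Longrightarrow> s \<in> Hom Set_cat t Y \<Longrightarrow>
      (X, Z, h) \<cdot>\<^bsub>Set_cat\<^esub> r = (Y, Z, k) \<cdot>\<^bsub>Set_cat\<^esub> s \<Longrightarrow>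
      \<exists>!m. m \<in> Hom Set_cat t W \<and> (W, X, f) \<cdot>\<^bsub>Set_cat\<^esub> m = r \<and> (W, Y, g) \<cdot>\<^bsub>Set_cat\<^esub> m = s"
    using assms by (auto simp: is_pullback_def Set_cat_def)
  moreover have "{x} \<in> Obj Set_cat" by (simp add: Set_cat_def)
  ultimately have ex: "\<exists>!m. m \<in> Hom Set_cat {x} W \<and>
      (W, X, f) \<cdot>\<^bsub>Set_cat\<^esub> m = ?r \<and> (W, Y, g) \<cdot>\<^bsub>Set_cat\<^esub> m = ?s" by blast
  show "\<exists>!w. w \<in> W \<and> f w = x \<and> g w = y"
  proof (rule ex_ex1I)
    obtain n where n: "n \<in> {x} \<rightarrow>\<^sub>E W" "compose {x} f n = (\<lambda>_\<in>{x}. x)"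
      "compose {x} g n = (\<lambda>_\<in>{x}. y)"
      using ex by (auto simp: Set_cat_def Hom_def)
    have "f (n x) = x" "g (n x) = y" "n x \<in> W"
      using fun_cong[OF n(2), of x] fun_cong[OF n(3), of x] n(1) by (auto simp: compose_def)
    then show "\<exists>w. w \<in> W \<and> f w = x \<and> g w = y" by blast
  next
    fix w w' assume w: "w \<in> W \<and> f w = x \<and> g w = y" and w': "w' \<in> W \<and> f w' = x \<and> g w' = y"
    let ?m = "\<lambda>w. ({x}, W, \<lambda>_\<in>{x}. w)"
    have "?m w'' \<in> Hom Set_cat {x} W \<and>
      (W, X, f) \<cdot>\<^bsub>Set_cat\<^esub> ?m w'' = ?r \<and> (W, Y, g) \<cdot>\<^bsub>Set_cat\<^esub> ?m w'' = ?s"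
      if "w'' \<in> W \<and> f w'' = x \<and> g w'' = y" for w''
      using that by (auto simp: Set_cat_def Hom_def compose_def)
    from this[OF w] this[OF w'] have "?m w = ?m w'" using ex by blast
    then show "w = w'" by (auto dest: fun_cong[of _ _ x])
  qed
qed

text \<open>The composites with \<open>m\<close> form a cone over \<open>u\<close> and
  \<open>v\<close>, and both \<open>m\<close> and \<open>m'\<close> mediate it.\<close>

lemma (in category) pullback_unique:
  assumes "is_pullback C p q u v" "p \<in> Hom C w x" "q \<in> Hom C w y"
    and "m \<in> Hom C t w" "m' \<in> Hom C t w" "p \<cdot> m = p \<cdot> m'" "q \<cdot> m = q \<cdot> m'"
  shows "m = m'"
proof -
  have d: "u \<in> Hom C x (Cod C u)" "v \<in> Hom C y (Cod C u)" "u \<cdot> p = v \<cdot> q"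
    using assms(1-3) by (auto simp: is_pullback_def Hom_def)
  have "u \<cdot> (p \<cdot> m) = v \<cdot> (q \<cdot> m)"
    using comp_assoc[OF d(1) assms(2,4)] comp_assoc[OF d(2) assms(3,4)] d(3) by simp
  moreover have "p \<cdot> m \<in> Hom C t (Dom C u)" "q \<cdot> m \<in> Hom C t (Dom C v)" "t \<in> Obj C"
    using comp_hom[OF assms(2,4)] comp_hom[OF assms(3,4)] d homD[OF assms(4)]
    by (auto simp: Hom_def)
  ultimately have "\<exists>!n. n \<in> Hom C t (Dom C p) \<and> p \<cdot> n = p \<cdot> m \<and> q \<cdot> n = q \<cdot> m"
    using assms(1) unfolding is_pullback_def by blast
  moreover have "Dom C p = w" using homD[OF assms(2)] by blast
  ultimately show ?thesis using assms(4-7) by metis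
qed

section \<open>The square of coproducts\<close>

theorem theorem7p3:
  fixes C :: "('o, 'm, 'i) coprod_cat"
    and W X Y Z :: "'i set"
    and a b c d :: "'i \<Rightarrow> 'o"
    and f g h k :: "'i \<Rightarrow> 'i"
    and fh gh hh kh :: "'i \<Rightarrow> 'm"
  assumes "extensive_category C"
    and "((W, a), (X, b), f, fh) \<in> Arr (Fam C)"
    and "((W, a), (Y, c), g, gh) \<in> Arr (Fam C)"
    and "((X, b), (Z, d), h, hh) \<in> Arr (Fam C)"
    and "((Y, c), (Z, d), k, kh) \<in> Arr (Fam C)"
    and "((X, b), (Z, d), h, hh) \<cdot>\<^bsub>Fam C\<^esub> ((W, a), (X, b), f, fh) =
         ((Y, c), (Z, d), k, kh) \<cdot>\<^bsub>Fam C\<^esub> ((W, a), (Y, c), g, gh)"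
    and "is_pullback Set_cat (W, X, f) (W, Y, g) (X, Z, h) (Y, Z, k)"
    and "\<forall>w \<in> W. is_pullback C (fh w) (gh w) (hh (f w)) (kh (g w))"
  shows "is_pullback C
           (fam_sum C ((W, a), (X, b), f, fh)) (fam_sum C ((W, a), (Y, c), g, gh))
           (fam_sum C ((X, b), (Z, d), h, hh)) (fam_sum C ((Y, c), (Z, d), k, kh))"
proof -
  interpret extensive_category C by fact
  have a: "a \<in> W \<rightarrow>\<^sub>E Obj C" and b: "b \<in> X \<rightarrow>\<^sub>E Obj C" and c: "c \<in> Y \<rightarrow>\<^sub>E Obj C"
    and d: "d \<in> Z \<rightarrow>\<^sub>E Obj C"
    and f: "f \<in> W \<rightarrow> X" and g: "g \<in> W \<rightarrow> Y" and h: "h \<in> X \<rightarrow> Z" and k: "k \<in> Y \<rightarrow> Z"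
    and fh': "fh \<in> (\<Pi> w \<in> W. Hom C (a w) (b (f w)))"
    and gh': "gh \<in> (\<Pi> w \<in> W. Hom C (a w) (c (g w)))"
    and hh': "hh \<in> (\<Pi> x \<in> X. Hom C (b x) (d (h x)))"
    and kh': "kh \<in> (\<Pi> y \<in> Y. Hom C (c y) (d (k y)))"
    using assms(2-5) by (auto simp: Fam_def)
  note fh = Pi_mem[OF fh'] and gh = Pi_mem[OF gh'] and hh = Pi_mem[OF hh'] and kh = Pi_mem[OF kh']
  let ?F = "fam_sum C ((W, a), (X, b), f, fh)" and ?G = "fam_sum C ((W, a), (Y, c), g, gh)"
    and ?H = "fam_sum C ((X, b), (Z, d), h, hh)" and ?K = "fam_sum C ((Y, c), (Z, d), k, kh)"
  note F = fam_sum[OF a b f fh'] and G = fam_sum[OF a c g gh']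
    and H = fam_sum[OF b d h hh'] and K = fam_sum[OF c d k kh']
  note F_inj = fam_sum_comp_inj[OF a b f fh'] and G_inj = fam_sum_comp_inj[OF a c g gh']
    and H_inj = fam_sum_comp_inj[OF b d h hh'] and K_inj = fam_sum_comp_inj[OF c d k kh']
  note sets = Set_pullback_unique[OF assms(7)]
  have pb: "\<And>w. w \<in> W \<Longrightarrow> is_pullback C (fh w) (gh w) (hh (f w)) (kh (g w))"
    using assms(8) by blast
  \<comment> \<open>On the injection at \<open>w\<close>, the square of sets matches the indices in
    \<open>Z\<close> and the square at \<open>w\<close> matches the components.\<close>
  have comm: "?H \<cdot>\<^bsub>C\<^esub> ?F = ?K \<cdot>\<^bsub>C\<^esub> ?G"
  proof (rule coproduct_eqI[OF coproduct[OF a] comp_hom[OF H(1) F(1)] comp_hom[OF K(1) G(1)]])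
    fix w assume w: "w \<in> W"
    have fw: "f w \<in> X" and gw: "g w \<in> Y" using f g w by auto
    have "?H \<cdot>\<^bsub>C\<^esub> ?F \<cdot>\<^bsub>C\<^esub> Inj C W a w = Inj C Z d (h (f w)) \<cdot>\<^bsub>C\<^esub> (hh (f w) \<cdot>\<^bsub>C\<^esub> fh w)"
      using comp_assoc[OF H(1) F(1) inj_hom[OF a w]] F(2)[OF w] H_inj[OF fw fh[OF w]] by simp
    also have "\<dots> = Inj C Z d (k (g w)) \<cdot>\<^bsub>C\<^esub> (kh (g w) \<cdot>\<^bsub>C\<^esub> gh w)"
      using pb[OF w] sets(1)[OF w] by (simp add: is_pullback_def)
    also have "\<dots> = ?K \<cdot>\<^bsub>C\<^esub> ?G \<cdot>\<^bsub>C\<^esub> Inj C W a w"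
      using comp_assoc[OF K(1) G(1) inj_hom[OF a w]] G(2)[OF w] K_inj[OF gw gh[OF w]] by simp
    finally show "?H \<cdot>\<^bsub>C\<^esub> ?F \<cdot>\<^bsub>C\<^esub> Inj C W a w = ?K \<cdot>\<^bsub>C\<^esub> ?G \<cdot>\<^bsub>C\<^esub> Inj C W a w" .
  qed
  \<comment> \<open>Existence for a piece \<open>u\<close> that lies over a single
    \<open>b x\<close> and a single \<open>c y\<close>.\<close>
  have local_lift: "\<exists>n \<in> Hom C u (Coprod C W a).
      ?F \<cdot>\<^bsub>C\<^esub> n = Inj C X b x \<cdot>\<^bsub>C\<^esub> r \<and> ?G \<cdot>\<^bsub>C\<^esub> n = Inj C Y c y \<cdot>\<^bsub>C\<^esub> s"
    if x: "x \<in> X" and y: "y \<in> Y" and r: "r \<in> Hom C u (b x)" and s: "s \<in> Hom C u (c y)"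
      and eq: "?H \<cdot>\<^bsub>C\<^esub> (Inj C X b x \<cdot>\<^bsub>C\<^esub> r) = ?K \<cdot>\<^bsub>C\<^esub> (Inj C Y c y \<cdot>\<^bsub>C\<^esub> s)"
    for u x y r s
  proof -
    have u: "u \<in> Obj C" using homD[OF r] by blast
    have r': "Inj C X b x \<cdot>\<^bsub>C\<^esub> r \<in> Hom C u (Coprod C X b)"
      and s': "Inj C Y c y \<cdot>\<^bsub>C\<^esub> s \<in> Hom C u (Coprod C Y c)"
      using comp_hom inj_hom b c x y r s by metis+
    have hx: "h x \<in> Z" and ky: "k y \<in> Z" using h k x y by auto
    have "Inj C Z d (h x) \<cdot>\<^bsub>C\<^esub> (hh x \<cdot>\<^bsub>C\<^esub> r) = Inj C Z d (k y) \<cdot>\<^bsub>C\<^esub> (kh y \<cdot>\<^bsub>C\<^esub> s)"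
      using eq H_inj[OF x r] K_inj[OF y s] by simp
    then consider "is_initial C u" | "h x = k y" "hh x \<cdot>\<^bsub>C\<^esub> r = kh y \<cdot>\<^bsub>C\<^esub> s"
      using inj_eq_cases[OF d hx ky comp_hom[OF hh[OF x] r] comp_hom[OF kh[OF y] s]] by blast
    then show ?thesis
    proof cases
      \<comment> \<open>Any arrow into \<open>Coprod C W a\<close> is a lift, since arrows out of an
        initial object with the same target coincide.\<close>
      case 1
      then obtain n where "n \<in> Hom C u (Coprod C W a)"
        using initial_arr[OF 1 coproduct_objs(1)[OF coproduct[OF a]]] by blast
      then show ?thesis
        using initial_eq[OF 1 _ r'] initial_eq[OF 1 _ s'] comp_hom[OF F(1)] comp_hom[OF G(1)]
        by blast
    next
      \<comment> \<open>The pullback of sets supplies the index \<open>w\<close>, the pullback at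
        \<open>w\<close> the component \<open>n\<close>; the lift is
        \<open>Inj C W a w \<cdot> n\<close>.\<close>
      case 2
      then obtain w where w: "w \<in> W" "f w = x" "g w = y"
        using sets(2)[OF x y] by blast
      then have "r \<in> Hom C u (Dom C (hh (f w)))" "s \<in> Hom C u (Dom C (kh (g w)))"
        "hh (f w) \<cdot>\<^bsub>C\<^esub> r = kh (g w) \<cdot>\<^bsub>C\<^esub> s"
        using 2 r s homD[OF hh[OF x]] homD[OF kh[OF y]] by auto
      then obtain n where "n \<in> Hom C u (Dom C (fh w))" "fh w \<cdot>\<^bsub>C\<^esub> n = r" "gh w \<cdot>\<^bsub>C\<^esub> n = s"
        using pb[OF w(1)] u unfolding is_pullback_def by blast
      then have n: "n \<in> Hom C u (a w)" "fh w \<cdot>\<^bsub>C\<^esub> n = r" "gh w \<cdot>\<^bsub>C\<^esub> n = s"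
        using homD[OF fh[OF w(1)]] by auto
      then show ?thesis
        using comp_hom[OF inj_hom[OF a w(1)] n(1)] F_inj[OF w(1) n(1)] G_inj[OF w(1) n(1)] w
        by auto
    qed
  qed
  \<comment> \<open>\<open>t\<close> is split along \<open>r\<close>, then each piece
    \<open>T x\<close> along the restriction of \<open>s\<close>; the local lifts are glued
    twice.\<close>
  have ex: "\<exists>m \<in> Hom C t (Coprod C W a). ?F \<cdot>\<^bsub>C\<^esub> m = r \<and> ?G \<cdot>\<^bsub>C\<^esub> m = s"
    if r: "r \<in> Hom C t (Coprod C X b)" and s: "s \<in> Hom C t (Coprod C Y c)"
      and eq: "?H \<cdot>\<^bsub>C\<^esub> r = ?K \<cdot>\<^bsub>C\<^esub> s" for t r s
  proof -
    obtain T \<iota> \<rho> where T: "is_coproduct C X T t \<iota>"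
      and \<rho>: "\<And>x. x \<in> X \<Longrightarrow> \<rho> x \<in> Hom C (T x) (b x)"
      and r\<iota>: "\<And>x. x \<in> X \<Longrightarrow> r \<cdot>\<^bsub>C\<^esub> \<iota> x = Inj C X b x \<cdot>\<^bsub>C\<^esub> \<rho> x"
      using decompose_over_coproduct[OF b r] by blast
    show ?thesis
    proof (rule coproduct_lift_glue[OF T F(1) G(1) r s])
      fix x assume x: "x \<in> X"
      note \<iota> = coproduct_objs(2)[OF T x]
      have r1: "r \<cdot>\<^bsub>C\<^esub> \<iota> x \<in> Hom C (T x) (Coprod C X b)" and s1: "s \<cdot>\<^bsub>C\<^esub> \<iota> x \<in> Hom C (T x) (Coprod C Y c)"
        using comp_hom r s \<iota> by blast+
      obtain U \<kappa> \<sigma> where U: "is_coproduct C Y U (T x) \<kappa>"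
        and \<sigma>: "\<And>y. y \<in> Y \<Longrightarrow> \<sigma> y \<in> Hom C (U y) (c y)"
        and s\<kappa>: "\<And>y. y \<in> Y \<Longrightarrow> s \<cdot>\<^bsub>C\<^esub> \<iota> x \<cdot>\<^bsub>C\<^esub> \<kappa> y = Inj C Y c y \<cdot>\<^bsub>C\<^esub> \<sigma> y"
        using decompose_over_coproduct[OF c s1] by blast
      show "\<exists>n \<in> Hom C (T x) (Coprod C W a). ?F \<cdot>\<^bsub>C\<^esub> n = r \<cdot>\<^bsub>C\<^esub> \<iota> x \<and> ?G \<cdot>\<^bsub>C\<^esub> n = s \<cdot>\<^bsub>C\<^esub> \<iota> x"
      proof (rule coproduct_lift_glue[OF U F(1) G(1) r1 s1])
        fix y assume y: "y \<in> Y"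
        note \<kappa> = coproduct_objs(2)[OF U y]
        have r2: "r \<cdot>\<^bsub>C\<^esub> \<iota> x \<cdot>\<^bsub>C\<^esub> \<kappa> y = Inj C X b x \<cdot>\<^bsub>C\<^esub> (\<rho> x \<cdot>\<^bsub>C\<^esub> \<kappa> y)"
          using comp_assoc[OF inj_hom[OF b x] \<rho>[OF x] \<kappa>] r\<iota>[OF x] by simp
        have "?H \<cdot>\<^bsub>C\<^esub> (r \<cdot>\<^bsub>C\<^esub> \<iota> x \<cdot>\<^bsub>C\<^esub> \<kappa> y) = ?K \<cdot>\<^bsub>C\<^esub> (s \<cdot>\<^bsub>C\<^esub> \<iota> x \<cdot>\<^bsub>C\<^esub> \<kappa> y)"
          using comp_assoc[OF H(1) r1 \<kappa>] comp_assoc[OF K(1) s1 \<kappa>]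
            comp_assoc[OF H(1) r \<iota>] comp_assoc[OF K(1) s \<iota>] eq by simp
        then show "\<exists>n \<in> Hom C (U y) (Coprod C W a).
            ?F \<cdot>\<^bsub>C\<^esub> n = r \<cdot>\<^bsub>C\<^esub> \<iota> x \<cdot>\<^bsub>C\<^esub> \<kappa> y \<and> ?G \<cdot>\<^bsub>C\<^esub> n = s \<cdot>\<^bsub>C\<^esub> \<iota> x \<cdot>\<^bsub>C\<^esub> \<kappa> y"
          unfolding r2 s\<kappa>[OF y] by (rule local_lift[OF x y comp_hom[OF \<rho>[OF x] \<kappa>] \<sigma>[OF y]])
      qed
    qed
  qed
  \<comment> \<open>Uniqueness for a piece on which both arrows factor through single
    injections.\<close>
  have local_unique: "Inj C W a w \<cdot>\<^bsub>C\<^esub> n = Inj C W a w' \<cdot>\<^bsub>C\<^esub> n'"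
    if w: "w \<in> W" and w': "w' \<in> W" and n: "n \<in> Hom C u (a w)" and n': "n' \<in> Hom C u (a w')"
      and eqF: "?F \<cdot>\<^bsub>C\<^esub> (Inj C W a w \<cdot>\<^bsub>C\<^esub> n) = ?F \<cdot>\<^bsub>C\<^esub> (Inj C W a w' \<cdot>\<^bsub>C\<^esub> n')"
      and eqG: "?G \<cdot>\<^bsub>C\<^esub> (Inj C W a w \<cdot>\<^bsub>C\<^esub> n) = ?G \<cdot>\<^bsub>C\<^esub> (Inj C W a w' \<cdot>\<^bsub>C\<^esub> n')"
    for u w w' n n'
  proof -
    have "f w \<in> X" "f w' \<in> X" and gw: "g w \<in> Y" "g w' \<in> Y" using f g w w' by auto
    then have cF: "is_initial C u \<or> f w = f w' \<and> fh w \<cdot>\<^bsub>C\<^esub> n = fh w' \<cdot>\<^bsub>C\<^esub> n'"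
      using inj_eq_cases[OF b _ _ comp_hom[OF fh[OF w] n] comp_hom[OF fh[OF w'] n']]
        F_inj[OF w n] F_inj[OF w' n'] eqF by simp
    have cG: "is_initial C u \<or> g w = g w' \<and> gh w \<cdot>\<^bsub>C\<^esub> n = gh w' \<cdot>\<^bsub>C\<^esub> n'"
      using inj_eq_cases[OF c gw comp_hom[OF gh[OF w] n] comp_hom[OF gh[OF w'] n']]
        G_inj[OF w n] G_inj[OF w' n'] eqG by simp
    show ?thesis
    proof (cases "is_initial C u")
      case True
      then show ?thesis
        using initial_eq comp_hom[OF inj_hom[OF a w] n] comp_hom[OF inj_hom[OF a w'] n'] by blast
    next
      case False
      \<comment> \<open>Both indices lie over the same pair in \<open>X\<close> and
        \<open>Y\<close>, so the pullback of sets identifies them.\<close>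
      then have "w = w'"
        using cF cG sets(2)[OF \<open>f w \<in> X\<close> gw(1) sets(1)[OF w]] w w' by metis
      then show ?thesis
        using pullback_unique[OF pb[OF w] fh[OF w] gh[OF w] n] n' cF cG False by simp
    qed
  qed
  \<comment> \<open>Splitting along \<open>m\<close> and then along the restriction of
    \<open>m'\<close> yields pieces on which each arrow factors through one injection.\<close>
  have uniq: "m = m'"
    if m: "m \<in> Hom C t (Coprod C W a)" and m': "m' \<in> Hom C t (Coprod C W a)"
      and eqF: "?F \<cdot>\<^bsub>C\<^esub> m = ?F \<cdot>\<^bsub>C\<^esub> m'" and eqG: "?G \<cdot>\<^bsub>C\<^esub> m = ?G \<cdot>\<^bsub>C\<^esub> m'" for t m m'
  proof -
    obtain T \<iota> \<mu> where T: "is_coproduct C W T t \<iota>"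
      and \<mu>: "\<And>w. w \<in> W \<Longrightarrow> \<mu> w \<in> Hom C (T w) (a w)"
      and m\<iota>: "\<And>w. w \<in> W \<Longrightarrow> m \<cdot>\<^bsub>C\<^esub> \<iota> w = Inj C W a w \<cdot>\<^bsub>C\<^esub> \<mu> w"
      using decompose_over_coproduct[OF a m] by blast
    show ?thesis
    proof (rule coproduct_eqI[OF T m m'])
      fix w assume w: "w \<in> W"
      note \<iota> = coproduct_objs(2)[OF T w]
      have m1: "m \<cdot>\<^bsub>C\<^esub> \<iota> w \<in> Hom C (T w) (Coprod C W a)"
        and m1': "m' \<cdot>\<^bsub>C\<^esub> \<iota> w \<in> Hom C (T w) (Coprod C W a)"
        using comp_hom m m' \<iota> by blast+
      obtain U \<kappa> \<nu> where U: "is_coproduct C W U (T w) \<kappa>"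
        and \<nu>: "\<And>w'. w' \<in> W \<Longrightarrow> \<nu> w' \<in> Hom C (U w') (a w')"
        and m\<kappa>: "\<And>w'. w' \<in> W \<Longrightarrow> m' \<cdot>\<^bsub>C\<^esub> \<iota> w \<cdot>\<^bsub>C\<^esub> \<kappa> w' = Inj C W a w' \<cdot>\<^bsub>C\<^esub> \<nu> w'"
        using decompose_over_coproduct[OF a m1'] by blast
      show "m \<cdot>\<^bsub>C\<^esub> \<iota> w = m' \<cdot>\<^bsub>C\<^esub> \<iota> w"
      proof (rule coproduct_eqI[OF U m1 m1'])
        fix w' assume w': "w' \<in> W"
        note \<kappa> = coproduct_objs(2)[OF U w']
        have m2: "m \<cdot>\<^bsub>C\<^esub> \<iota> w \<cdot>\<^bsub>C\<^esub> \<kappa> w' = Inj C W a w \<cdot>\<^bsub>C\<^esub> (\<mu> w \<cdot>\<^bsub>C\<^esub> \<kappa> w')"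
          using comp_assoc[OF inj_hom[OF a w] \<mu>[OF w] \<kappa>] m\<iota>[OF w] by simp
        \<comment> \<open>Used with \<open>P\<close> equal to \<open>?F\<close> and to
          \<open>?G\<close>, to carry the two assumed equations down to a piece.\<close>
        have restr: "P \<cdot>\<^bsub>C\<^esub> (m \<cdot>\<^bsub>C\<^esub> \<iota> w \<cdot>\<^bsub>C\<^esub> \<kappa> w') = P \<cdot>\<^bsub>C\<^esub> (m' \<cdot>\<^bsub>C\<^esub> \<iota> w \<cdot>\<^bsub>C\<^esub> \<kappa> w')"
          if P: "P \<in> Hom C (Coprod C W a) v" and eq: "P \<cdot>\<^bsub>C\<^esub> m = P \<cdot>\<^bsub>C\<^esub> m'" for P v
          using comp_assoc[OF P m1 \<kappa>] comp_assoc[OF P m1' \<kappa>]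
            comp_assoc[OF P m \<iota>] comp_assoc[OF P m' \<iota>] eq by simp
        show "m \<cdot>\<^bsub>C\<^esub> \<iota> w \<cdot>\<^bsub>C\<^esub> \<kappa> w' = m' \<cdot>\<^bsub>C\<^esub> \<iota> w \<cdot>\<^bsub>C\<^esub> \<kappa> w'"
          using local_unique[OF w w' comp_hom[OF \<mu>[OF w] \<kappa>] \<nu>[OF w']]
            restr[OF F(1) eqF] restr[OF G(1) eqG] unfolding m2 m\<kappa>[OF w'] by blast
      qed
    qed
  qed
  have objs: "Dom C ?F = Coprod C W a" "Dom C ?H = Coprod C X b" "Dom C ?K = Coprod C Y c"
    using homD[OF F(1)] homD[OF H(1)] homD[OF K(1)] by simp_all
  show ?thesis
    unfolding is_pullback_def objs
  proof (intro conjI ballI impI)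
    fix t r s
    assume "r \<in> Hom C t (Coprod C X b)" "s \<in> Hom C t (Coprod C Y c)" "?H \<cdot>\<^bsub>C\<^esub> r = ?K \<cdot>\<^bsub>C\<^esub> s"
    from ex[OF this] uniq
    show "\<exists>!m. m \<in> Hom C t (Coprod C W a) \<and> ?F \<cdot>\<^bsub>C\<^esub> m = r \<and> ?G \<cdot>\<^bsub>C\<^esub> m = s"
      by metis
  qed (use homD[OF F(1)] homD[OF G(1)] homD[OF H(1)] homD[OF K(1)] comm in simp_all)
qed

end
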